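(* Let $s\in\mathbb{N}_+$ and let $f\in C^s[0,1]$ be real-valued. If \[ \lim_{n\to\infty}\|\widetilde{B}_n(f)-f\|=0\quad\text{and}\quad\lim_{n\to\infty}\|(\widetilde{B}_n(f))^{(s)}-f^{(s)}\|=0, \] then $f^{(i)}(0)=f^{(i)}(1)=0$ for $i=2,\dots,s$, and there exists $n_0\in\mathbb{N}_+$, $n_0\ge s$, such that \[ f\left(\frac{k}{n}\right)\ge f(0)+\frac{k}{n}\,f'(0),\quad k=1,\dots,s,\ n\ge n_0, \] \[ f\left(\frac{k}{n}\right)\ge f(1)-\left(1-\frac{k}{n}\right)f'(1),\quad k=n-s,\dots,n-1,\ n\ge n_0. \]
   Context: $\mathbb{N}_+$ is the set of positive integers. $\|\cdot\|$ is the sup-norm on $[0,1]$. $C^s[0,1]$ is the space of real functions with $s$ continuous derivatives on $[0,1]$ (one-sided at the endpoints). For $s=1$ the condition on $f^{(i)}$, $i=2,\dots,s$, is vacuous. For real $\alpha$, $[\alpha]$ denotes the largest integer less than or equal to $\alpha$. For $f\in C[0,1]$, $n\in\mathbb{N}_+$, $x\in[0,1]$, \[ \widetilde{B}_n(f)(x):=\sum_{k=0}^n\left[f\left(\frac kn\right)\binom nk\right]x^k(1-x)^{n-k}. \] *)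

theory Defs
  imports "HOL-Analysis.Analysis"
begin

text \<open>Functions on $[0,1]$ are represented by total functions on the reals of which only the
  values on $[0,1]$ matter. Differentiating within $[0,1]$ gives the one-sided derivatives at
  the endpoints; outside $[0,1]$ the value of \<open>deriv01\<close> is unspecified and has no influence on
  its values (or those of further derivatives) at points of $[0,1]$.\<close>

definition deriv01 :: "nat \<Rightarrow> (real \<Rightarrow> real) \<Rightarrow> real \<Rightarrow> real" where
  "deriv01 i = (\<lambda>f x. vector_derivative f (at x within {0..1})) ^^ i"

definition C_on01 :: "nat \<Rightarrow> (real \<Rightarrow> real) \<Rightarrow> bool" where
  "C_on01 s f \<longleftrightarrow>
     (\<forall>i<s. deriv01 i f differentiable_on {0..1}) \<and> continuous_on {0..1} (deriv01 s f)"

text \<open>The real-valued supremum is meaningful only for functions bounded on $[0,1]$,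
  for instance continuous ones.\<close>

definition sup_norm01 :: "(real \<Rightarrow> real) \<Rightarrow> real" where
  "sup_norm01 g = (SUP x\<in>{0..1}. \<bar>g x\<bar>)"

definition int_bernstein :: "nat \<Rightarrow> (real \<Rightarrow> real) \<Rightarrow> real \<Rightarrow> real" where
  "int_bernstein n f x =
     (\<Sum>k=0..n. real_of_int \<lfloor>f (real k / real n) * real (n choose k)\<rfloor> * x ^ k * (1 - x) ^ (n - k))"

end

theory Submission
  imports Defs
begin

text \<open>Uniform convergence of a sequence of functions and of their derivatives of order \<open>s\<close> implies
  convergence of all derivatives up to order \<open>s\<close> at the endpoint \<open>0\<close>
  (\<open>Taylor_coefficients_tendsto_zero\<close>). For the integer Bernstein polynomials
  these derivatives are \<open>i!\<close> times integers, so the low coefficients do not merely converge but are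
  eventually constant: up to order \<open>s\<close> they are exactly the Taylor coefficients of \<open>f\<close>, and in
  particular \<open>f 0\<close> and \<open>f' 0\<close> are integers.

  The coefficient with index \<open>k\<close> is, at the same time, \<open>f (k / n) * (n choose k)\<close> rounded down. If the
  first nonlinear Taylor term of \<open>f\<close> at \<open>0\<close> is \<open>\<gamma> * x ^ k\<close>, this contributes about
  \<open>\<gamma> * k ^ k / k!\<close>, while exactness of the Taylor coefficients demands \<open>\<gamma>\<close>. The two differ by at
  most the rounding error, which is possible only for \<open>\<gamma> = 0\<close>, or for \<open>k = 2\<close> and \<open>\<gamma> = 1\<close>.
  This last case is not visible in the derivatives at \<open>0\<close>. It is excluded by
  \<open>no_unit_quadratic_start\<close>: uniform convergence makes the approximation error at \<open>x = 1 / n\<close>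
  of smaller order than \<open>x\<^sup>2\<close> (\<open>quadratic_error_tendsto_zero\<close>), but the polynomial exceeds
  the tangent there by at least about \<open>(2 - 2 / e) * x\<^sup>2\<close> instead of \<open>x\<^sup>2\<close>.

  Hence all derivatives of \<open>f\<close> at \<open>0\<close> of order \<open>2, \<dots>, s\<close> vanish, the first \<open>s\<close> rounded
  coefficients are those of the tangent, and since they are at most \<open>f (k / n) * (n choose k)\<close>, the
  function lies above its tangent at \<open>k / n\<close> (\<open>affine_contact_at_zero\<close>). The
  endpoint \<open>1\<close> follows by applying this to \<open>f (1 - x)\<close>, whose integer Bernstein polynomials
  are the reflected ones (\<open>int_bernstein_reflect\<close>).\<close>

section \<open>Limits of sequences\<close>

lemma binomial_over_power_tendsto:
  "(\<lambda>n. real (n choose k) / real n ^ k) \<longlonglongrightarrow> 1 / fact k"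
proof (induction k)
  case 0
  then show ?case by simp
next
  case (Suc k)
  have lim: "(\<lambda>n. (1 - real k / real n) / (real k + 1)) \<longlonglongrightarrow> (1 - 0) / (real k + 1)"
    by (intro tendsto_intros lim_const_over_n) auto
  have "(\<lambda>n. real (n choose k) / real n ^ k * ((1 - real k / real n) / (real k + 1)))
      \<longlonglongrightarrow> 1 / fact k * (1 / (real k + 1))"
    using tendsto_mult[OF Suc.IH lim] by simp
  moreover have "\<forall>\<^sub>F n in sequentially.
      real (n choose k) / real n ^ k * ((1 - real k / real n) / (real k + 1))
        = real (n choose Suc k) / real n ^ Suc k"
    using eventually_ge_at_top[of "Suc k"]
  proof eventually_elim
    case (elim n)
    have "Suc k * (n choose Suc k) = (n - k) * (n choose k)"
      by (metis binomial_absorb_comp binomial_absorption)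
    then have "(real k + 1) * real (n choose Suc k) = (real n - real k) * real (n choose k)"
      using elim by (metis Suc_leD add.commute of_nat_Suc of_nat_diff of_nat_mult)
    then have "real (n choose Suc k) = (real n - real k) * real (n choose k) / (real k + 1)"
      by (simp add: field_simps)
    moreover have "real (n choose k) / real n ^ k * ((1 - real k / real n) / (real k + 1))
        = (real n - real k) * real (n choose k) / (real k + 1) / real n ^ Suc k"
    proof -
      have "1 - real k / real n = (real n - real k) / real n"
        using elim by (simp add: diff_divide_distrib)
      then show ?thesis by (simp add: ac_simps)
    qed
    ultimately show ?case by simp
  qed
  ultimately have "(\<lambda>n. real (n choose Suc k) / real n ^ Suc k) \<longlonglongrightarrow> 1 / fact k * (1 / (real k + 1))"
    by (rule Lim_transform_eventually)
  then show ?case by (simp add: algebra_simps)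
qed

lemma two_fact_less_self_power:
  assumes "3 \<le> k"
  shows "2 * fact k < (real k ^ k)"
  using assms
proof (induction k rule: dec_induct)
  case base
  then show ?case by (simp add: fact_numeral)
next
  case (step k)
  have "2 * fact (Suc k) = real (Suc k) * (2 * fact k)"
    by (simp add: algebra_simps)
  also have "\<dots> < real (Suc k) * real k ^ k"
    using step.IH by (intro mult_strict_left_mono) auto
  also have "\<dots> \<le> real (Suc k) * real (Suc k) ^ k"
    by (intro mult_left_mono power_mono) auto
  finally show ?case by simp
qed

lemma Ints_tendsto_eventually_eq:
  fixes a :: "nat \<Rightarrow> real"
  assumes lim: "a \<longlonglongrightarrow> L" and int: "\<forall>\<^sub>F n in sequentially. a n \<in> \<int>"
  shows "L \<in> \<int>" and "\<forall>\<^sub>F n in sequentially. a n = L"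
proof -
  show L: "L \<in> \<int>"
    by (rule Lim_in_closed_set[OF closed_Ints int _ lim]) simp
  have "\<forall>\<^sub>F n in sequentially. dist (a n) L < 1"
    using lim by (rule tendstoD) simp
  with int show "\<forall>\<^sub>F n in sequentially. a n = L"
  proof eventually_elim
    case (elim n)
    then show ?case using L by (auto simp: dist_real_def elim!: Ints_cases)
  qed
qed

text \<open>On polynomials of bounded degree, pointwise convergence forces convergence of the
  coefficients. The combination \<open>q x - 2 ^ m * q (x / 2)\<close> removes the leading coefficient of
  a polynomial \<open>q\<close> of degree \<open>m\<close> and multiplies the others by fixed nonzero constants, so
  that induction on the degree applies to it.\<close>

lemma coefficients_tendsto_zero:
  fixes c :: "nat \<Rightarrow> nat \<Rightarrow> real"
  assumes "\<And>x. x \<in> {0..1} \<Longrightarrow> (\<lambda>n. \<Sum>i<m. c n i * x ^ i) \<longlonglongrightarrow> 0"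
    and "i < m"
  shows "(\<lambda>n. c n i) \<longlonglongrightarrow> 0"
  using assms
proof (induction m arbitrary: c i)
  case 0
  then show ?case by simp
next
  case (Suc m)
  have low: "(\<lambda>n. c n j) \<longlonglongrightarrow> 0" if "j < m" for j
  proof -
    have "(\<lambda>n. c n j * (1 - 2 ^ (m - j))) \<longlonglongrightarrow> 0"
    proof (rule Suc.IH[OF _ that])
      fix x :: real assume x: "x \<in> {0..1}"
      have "(\<lambda>n. (\<Sum>i<Suc m. c n i * x ^ i) - 2 ^ m * (\<Sum>i<Suc m. c n i * (x / 2) ^ i))
          \<longlonglongrightarrow> 0 - 2 ^ m * 0"
        using x by (intro tendsto_intros Suc.prems(1)) auto
      moreover have "(\<Sum>i<Suc m. c n i * x ^ i) - 2 ^ m * (\<Sum>i<Suc m. c n i * (x / 2) ^ i)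
          = (\<Sum>i<m. c n i * (1 - 2 ^ (m - i)) * x ^ i)" for n
      proof -
        have "(\<Sum>i<Suc m. c n i * x ^ i) - 2 ^ m * (\<Sum>i<Suc m. c n i * (x / 2) ^ i)
            = (\<Sum>i<Suc m. c n i * (1 - 2 ^ (m - i)) * x ^ i)"
          unfolding sum_distrib_left sum_subtractf[symmetric]
        proof (intro sum.cong refl)
          fix i assume "i \<in> {..<Suc m}"
          then have "(2::real) ^ m = 2 ^ (m - i) * 2 ^ i" by (simp flip: power_add)
          then show "c n i * x ^ i - 2 ^ m * (c n i * (x / 2) ^ i) = c n i * (1 - 2 ^ (m - i)) * x ^ i"
            by (simp add: power_divide right_diff_distrib left_diff_distrib)
        qed
        then show ?thesis by simp
      qed
      ultimately show "(\<lambda>n. \<Sum>i<m. c n i * (1 - 2 ^ (m - i)) * x ^ i) \<longlonglongrightarrow> 0"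
        by simp
    qed
    then have "(\<lambda>n. c n j * (1 - 2 ^ (m - j)) * (1 / (1 - 2 ^ (m - j)))) \<longlonglongrightarrow> 0"
      by (rule tendsto_mult_left_zero)
    moreover have "1 < (2::real) ^ (m - j)"
      using that by (intro one_less_power) auto
    ultimately show ?thesis by simp
  qed
  show ?case
  proof (cases "i = m")
    case True
    have "(\<lambda>n. (\<Sum>i<Suc m. c n i * 1 ^ i) - (\<Sum>i<m. c n i)) \<longlonglongrightarrow> 0 - (\<Sum>i<m. 0)"
      by (intro tendsto_diff tendsto_sum Suc.prems(1) low) auto
    then show ?thesis by (simp add: True)
  qed (use low Suc.prems(2) in auto)
qed

section \<open>Taylor expansion at the left endpoint\<close>

text \<open>Throughout, the derivatives of a function are given as a sequence \<open>D 0, D 1, \<dots>\<close> of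
  functions, each the derivative of the preceding one within the interval. This covers one-sided
  derivatives at the endpoints, and it makes the passage to \<open>f (1 - x)\<close> a mere change of
  sequence.\<close>

lemma Taylor_remainder_bound_at_zero:
  fixes D :: "nat \<Rightarrow> real \<Rightarrow> real"
  assumes "1 \<le> k" and "0 \<le> b"
    and der: "\<And>i x. i < k \<Longrightarrow> x \<in> {0..b} \<Longrightarrow>
      (D i has_real_derivative D (Suc i) x) (at x within {0..b})"
    and bound: "\<And>x. x \<in> {0..b} \<Longrightarrow> \<bar>D k x\<bar> \<le> B"
    and x: "x \<in> {0..b}"
  shows "\<bar>D 0 x - (\<Sum>i<k. D i 0 / fact i * x ^ i)\<bar> \<le> B * x ^ k"
proof -
  obtain m where k: "k = Suc m" using assms(1) by (cases k) auto
  have "0 \<le> B" using bound[OF x] by linarith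
  have "norm (D 0 x - (\<Sum>i\<le>m. D i 0 * (x - 0) ^ i / fact i)) \<le> B * norm (x - 0) ^ Suc m / fact m"
    using der bound x \<open>0 \<le> b\<close> k
    by (intro field_Taylor[where S = "{0..b}"]) auto
  also have "\<dots> \<le> B * norm (x - 0) ^ Suc m"
    using \<open>0 \<le> B\<close> mult_left_mono[OF fact_ge_1[of m], of "B * norm (x - 0) ^ Suc m"]
    by (simp add: divide_le_eq del: power_Suc)
  finally show ?thesis using x by (simp add: k lessThan_Suc_atMost mult.commute)
qed

text \<open>Subtracting the \<open>k\<close>-th Taylor monomial from \<open>D 0\<close> leaves a function whose \<open>k\<close>-th derivative
  vanishes at \<open>0\<close>, hence is small near \<open>0\<close> by continuity; the remainder bound
  on a short interval is then a small multiple of \<open>x ^ k\<close>.\<close>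

lemma Taylor_Peano_at_zero:
  fixes D :: "nat \<Rightarrow> real \<Rightarrow> real"
  assumes "1 \<le> k"
    and der: "\<And>i x. i < k \<Longrightarrow> x \<in> {0..1} \<Longrightarrow>
      (D i has_real_derivative D (Suc i) x) (at x within {0..1})"
    and cont: "continuous_on {0..1} (D k)"
  shows "((\<lambda>x. (D 0 x - (\<Sum>i<k. D i 0 / fact i * x ^ i)) / x ^ k) \<longlongrightarrow> D k 0 / fact k) (at_right 0)"
proof (rule tendstoI)
  fix e' :: real assume "0 < e'"
  define e where "e = e' / 2"
  have "0 < e" "e < e'" using \<open>0 < e'\<close> by (auto simp: e_def)
  obtain d0 where d0: "0 < d0" "\<And>x. x \<in> {0..1} \<Longrightarrow> dist x 0 < d0 \<Longrightarrow> dist (D k x) (D k 0) < e"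
    using cont[unfolded continuous_on_iff, rule_format, of 0 e] \<open>0 < e\<close> by auto
  define d where "d = min 1 (d0 / 2)"
  have d: "0 < d" "d \<le> 1" "d < d0" using d0 by (auto simp: d_def)
  define F where "F i x = D i x - (if i \<le> k then D k 0 * x ^ (k - i) / fact (k - i) else 0)" for i x
  have "\<bar>F 0 x - (\<Sum>i<k. F i 0 / fact i * x ^ i)\<bar> \<le> e * x ^ k" if x: "x \<in> {0..d}" for x
  proof (rule Taylor_remainder_bound_at_zero[OF \<open>1 \<le> k\<close> _ _ _ x])
    fix i y assume i: "i < k" and y: "y \<in> {0..d}"
    define m where "m = k - Suc i"
    have m: "k - i = Suc m" using i by (simp add: m_def)
    have "(D i has_real_derivative D (Suc i) y) (at y within {0..d})"
    proof (rule has_field_derivative_subset)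
      show "(D i has_real_derivative D (Suc i) y) (at y within {0..1})"
        using y d by (intro der[OF i]) auto
    qed (use d in auto)
    moreover have "((\<lambda>x. D k 0 * x ^ Suc m / fact (Suc m)) has_real_derivative
        D k 0 * (real (Suc m) * y ^ m) / fact (Suc m)) (at y within {0..d})"
      by (intro DERIV_cdivide DERIV_cmult) (use DERIV_pow[of "Suc m" y "{0..d}"] in simp)
    ultimately have "((\<lambda>x. D i x - D k 0 * x ^ Suc m / fact (Suc m)) has_real_derivative
        D (Suc i) y - D k 0 * (real (Suc m) * y ^ m) / fact (Suc m)) (at y within {0..d})"
      by (rule DERIV_diff)
    moreover have "D k 0 * (real (Suc m) * y ^ m) / fact (Suc m) = D k 0 * y ^ m / fact m"
      by (simp add: fact_Suc)
    moreover have "F i = (\<lambda>x. D i x - D k 0 * x ^ Suc m / fact (Suc m))"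
      using i by (auto simp: F_def m)
    moreover have "F (Suc i) y = D (Suc i) y - D k 0 * y ^ m / fact m"
      using i by (auto simp: F_def m_def)
    ultimately show "(F i has_real_derivative F (Suc i) y) (at y within {0..d})"
      by (simp only:)
  next
    fix y assume "y \<in> {0..d}"
    then show "\<bar>F k y\<bar> \<le> e" using d0(2)[of y] d by (auto simp: F_def dist_real_def)
  qed (use d in auto)
  moreover have "F 0 x - (\<Sum>i<k. F i 0 / fact i * x ^ i)
      = D 0 x - (\<Sum>i<k. D i 0 / fact i * x ^ i) - D k 0 / fact k * x ^ k" for x
  proof -
    have "(\<Sum>i<k. F i 0 / fact i * x ^ i) = (\<Sum>i<k. D i 0 / fact i * x ^ i)"
      by (intro sum.cong) (auto simp: F_def)
    then show ?thesis by (simp add: F_def)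
  qed
  ultimately have approx:
    "\<bar>D 0 x - (\<Sum>i<k. D i 0 / fact i * x ^ i) - D k 0 / fact k * x ^ k\<bar> \<le> e * x ^ k"
    if "x \<in> {0..d}" for x using that by metis
  show "\<forall>\<^sub>F x in at_right 0.
      dist ((D 0 x - (\<Sum>i<k. D i 0 / fact i * x ^ i)) / x ^ k) (D k 0 / fact k) < e'"
    unfolding eventually_at_right_field
  proof (intro exI[of _ d] conjI allI impI)
    fix x assume x: "0 < x" "x < d"
    define R where "R = D 0 x - (\<Sum>i<k. D i 0 / fact i * x ^ i)"
    have "dist (R / x ^ k) (D k 0 / fact k) = \<bar>R - D k 0 / fact k * x ^ k\<bar> / x ^ k"
    proof -
      have "R / x ^ k - D k 0 / fact k = (R - D k 0 / fact k * x ^ k) / x ^ k"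
        using x by (simp add: diff_divide_distrib)
      then show ?thesis using x by (simp only: dist_real_def abs_divide) simp
    qed
    also have "\<dots> \<le> e"
      using approx[of x] x by (simp add: R_def divide_le_eq)
    finally show "dist ((D 0 x - (\<Sum>i<k. D i 0 / fact i * x ^ i)) / x ^ k) (D k 0 / fact k) < e'"
      using \<open>e < e'\<close> by (simp add: R_def)
  qed (use d in auto)
qed

text \<open>Smallness of a function and of its derivative of order \<open>s\<close> passes to the intermediate
  derivatives: by Taylor's formula the Taylor polynomials of degree less than \<open>s\<close> tend to zero
  pointwise, and hence so do their coefficients.\<close>

lemma Taylor_coefficients_tendsto_zero:
  fixes H :: "nat \<Rightarrow> nat \<Rightarrow> real \<Rightarrow> real"
  assumes "1 \<le> s"
    and der: "\<And>n i x. i < s \<Longrightarrow> x \<in> {0..1} \<Longrightarrow>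
      (H n i has_real_derivative H n (Suc i) x) (at x within {0..1})"
    and pw: "\<And>x. x \<in> {0..1} \<Longrightarrow> (\<lambda>n. H n 0 x) \<longlonglongrightarrow> 0"
    and bound: "\<And>n x. x \<in> {0..1} \<Longrightarrow> \<bar>H n s x\<bar> \<le> e n"
    and "e \<longlonglongrightarrow> 0"
    and "i \<le> s"
  shows "(\<lambda>n. H n i 0) \<longlonglongrightarrow> 0"
proof (cases "i = s")
  case True
  show ?thesis unfolding True
    by (rule Lim_null_comparison[OF _ \<open>e \<longlonglongrightarrow> 0\<close>]) (use bound in auto)
next
  case False
  have "(\<lambda>n. H n i 0 / fact i) \<longlonglongrightarrow> 0"
  proof (rule coefficients_tendsto_zero[where c = "\<lambda>n i. H n i 0 / fact i" and m = s])
    fix x :: real assume x: "x \<in> {0..1}"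
    have "(\<lambda>n. H n 0 x - (\<Sum>i<s. H n i 0 / fact i * x ^ i)) \<longlonglongrightarrow> 0"
    proof (rule Lim_null_comparison)
      have "\<bar>H n 0 x - (\<Sum>i<s. H n i 0 / fact i * x ^ i)\<bar> \<le> e n * x ^ s" for n
        by (rule Taylor_remainder_bound_at_zero[where b = 1])
          (use \<open>1 \<le> s\<close> der bound x in auto)
      then show "\<forall>\<^sub>F n in sequentially. norm (H n 0 x - (\<Sum>i<s. H n i 0 / fact i * x ^ i)) \<le> e n * x ^ s"
        by simp
      show "(\<lambda>n. e n * x ^ s) \<longlonglongrightarrow> 0"
        using \<open>e \<longlonglongrightarrow> 0\<close> by (rule tendsto_mult_left_zero)
    qed
    from tendsto_diff[OF pw[OF x] this]
    show "(\<lambda>n. \<Sum>i<s. H n i 0 / fact i * x ^ i) \<longlonglongrightarrow> 0" by simp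
  qed (use False \<open>i \<le> s\<close> in auto)
  from tendsto_mult_left_zero[OF this, of "fact i"] show ?thesis by simp
qed

text \<open>Once the value and the slope at \<open>0\<close> vanish exactly, every remaining Taylor term carries
  a factor \<open>x\<^sup>2\<close>. The error is then \<open>o(x\<^sup>2)\<close> uniformly in \<open>x\<close>, even at points \<open>X n\<close> that
  approach \<open>0\<close> with \<open>n\<close>.\<close>

lemma quadratic_error_tendsto_zero:
  fixes H :: "nat \<Rightarrow> nat \<Rightarrow> real \<Rightarrow> real"
  assumes "2 \<le> s"
    and der: "\<And>n i x. i < s \<Longrightarrow> x \<in> {0..1} \<Longrightarrow>
      (H n i has_real_derivative H n (Suc i) x) (at x within {0..1})"
    and bound: "\<And>n x. x \<in> {0..1} \<Longrightarrow> \<bar>H n s x\<bar> \<le> e n"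
    and "e \<longlonglongrightarrow> 0"
    and coeffs: "\<And>i. i \<le> s \<Longrightarrow> (\<lambda>n. H n i 0) \<longlonglongrightarrow> 0"
    and zero: "\<forall>\<^sub>F n in sequentially. H n 0 0 = 0 \<and> H n 1 0 = 0"
    and X: "\<forall>\<^sub>F n in sequentially. X n \<in> {0<..1}"
  shows "(\<lambda>n. H n 0 (X n) / (X n)\<^sup>2) \<longlonglongrightarrow> 0"
proof (rule Lim_null_comparison)
  have "(\<lambda>n. (\<Sum>i=2..<s. \<bar>H n i 0\<bar> / fact i) + e n) \<longlonglongrightarrow> (\<Sum>i=2..<s. \<bar>0\<bar> / fact i) + 0"
    by (intro tendsto_intros coeffs \<open>e \<longlonglongrightarrow> 0\<close>) auto
  then show "(\<lambda>n. (\<Sum>i=2..<s. \<bar>H n i 0\<bar> / fact i) + e n) \<longlonglongrightarrow> 0" by simp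
  show "\<forall>\<^sub>F n in sequentially. norm (H n 0 (X n) / (X n)\<^sup>2) \<le> (\<Sum>i=2..<s. \<bar>H n i 0\<bar> / fact i) + e n"
    using zero X
  proof eventually_elim
    case (elim n)
    define x where "x = X n"
    have x: "0 < x" "x \<le> 1" using elim by (auto simp: x_def)
    have small: "x ^ i \<le> x\<^sup>2" if "2 \<le> i" for i
      using that x by (intro power_decreasing) auto
    have "{..<s} = {0, 1} \<union> {2..<s}" using \<open>2 \<le> s\<close> by auto
    then have split: "(\<Sum>i<s. H n i 0 / fact i * x ^ i) = (\<Sum>i=2..<s. H n i 0 / fact i * x ^ i)"
      using elim by (simp add: sum.union_disjoint)
    have "\<bar>H n 0 x - (\<Sum>i<s. H n i 0 / fact i * x ^ i)\<bar> \<le> e n * x ^ s"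
      by (rule Taylor_remainder_bound_at_zero[where b = 1])
        (use \<open>2 \<le> s\<close> der bound x in auto)
    moreover have "e n * x ^ s \<le> e n * x\<^sup>2"
      using small[OF \<open>2 \<le> s\<close>] bound[of 0 n] by (intro mult_left_mono) auto
    moreover have "\<bar>\<Sum>i=2..<s. H n i 0 / fact i * x ^ i\<bar> \<le> (\<Sum>i=2..<s. \<bar>H n i 0\<bar> / fact i) * x\<^sup>2"
      unfolding sum_distrib_right
    proof (intro order.trans[OF sum_abs] sum_mono)
      fix i assume "i \<in> {2..<s}"
      then have "\<bar>H n i 0\<bar> / fact i * x ^ i \<le> \<bar>H n i 0\<bar> / fact i * x\<^sup>2"
        using small by (intro mult_left_mono) auto
      then show "\<bar>H n i 0 / fact i * x ^ i\<bar> \<le> \<bar>H n i 0\<bar> / fact i * x\<^sup>2"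
        using x by (simp add: abs_mult)
    qed
    ultimately have "\<bar>H n 0 x\<bar> \<le> ((\<Sum>i=2..<s. \<bar>H n i 0\<bar> / fact i) + e n) * x\<^sup>2"
      unfolding split by (simp add: algebra_simps)
    then show ?case using x by (simp add: x_def[symmetric] divide_le_eq)
  qed
qed

section \<open>Polynomials in Bernstein form\<close>

text \<open>The basis polynomials carry no binomial factor, since the rounding in the integer Bernstein
  operator takes place after multiplication by it. With this normalisation the coefficients
  \<open>r k\<close> and the monomial coefficients are related by a unitriangular integer matrix.\<close>

definition bernstein_form :: "nat \<Rightarrow> (nat \<Rightarrow> real) \<Rightarrow> real poly" where
  "bernstein_form n r = (\<Sum>k\<le>n. smult (r k) (monom 1 k * [:1, -1:] ^ (n - k)))"

lemma poly_bernstein_form: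
  "poly (bernstein_form n r) x = (\<Sum>k\<le>n. r k * x ^ k * (1 - x) ^ (n - k))"
  by (simp add: bernstein_form_def poly_sum poly_monom mult.assoc)

lemma bernstein_form_diff:
  "bernstein_form n (\<lambda>k. a k - b k) = bernstein_form n a - bernstein_form n b"
  by (simp add: bernstein_form_def smult_diff_left sum_subtractf)

text \<open>The basis polynomial of index \<open>j\<close> starts with the monomial \<open>x ^ j\<close>, with coefficient
  \<open>1\<close>. Hence the first nonzero coefficient is the same in both bases.\<close>

lemma coeff_bernstein_form_first:
  assumes "\<And>j. j < k \<Longrightarrow> r j = 0" and "k \<le> n"
  shows "coeff (bernstein_form n r) k = r k"
proof -
  have "coeff (bernstein_form n r) k = (\<Sum>j\<le>n. if j = k then r k else 0)"
    unfolding bernstein_form_def coeff_sum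
  proof (intro sum.cong refl)
    fix j assume "j \<in> {..n}"
    show "coeff (smult (r j) (monom 1 j * [:1, -1:] ^ (n - j))) k = (if j = k then r k else 0)"
      using assms(1)[of j]
      by (cases j k rule: linorder_cases) (auto simp: coeff_monom_mult poly_0_coeff_0[symmetric])
  qed
  then show ?thesis using \<open>k \<le> n\<close> by simp
qed

lemma bernstein_form_affine:
  assumes "1 \<le> n"
  shows "bernstein_form n (\<lambda>k. real (n choose k) * (c + d * (real k / real n))) = [:c, d:]"
proof -
  have "poly (bernstein_form n (\<lambda>k. real (n choose k) * (c + d * (real k / real n)))) x
      = poly [:c, d:] x" for x
  proof -
    have "poly (bernstein_form n (\<lambda>k. real (n choose k) * (c + d * (real k / real n)))) x
        = c * (\<Sum>k\<le>n. Bernstein n k x) + d / real n * (\<Sum>k\<le>n. real k * Bernstein n k x)"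
      unfolding poly_bernstein_form sum_distrib_left sum.distrib[symmetric]
      by (intro sum.cong refl) (simp add: Bernstein_def field_simps)
    then show ?thesis using assms by simp
  qed
  then show ?thesis by (intro poly_eq_poly_eq_iff[THEN iffD1] ext)
qed

section \<open>Excluding a leading term with coefficient one\<close>

text \<open>The bound \<open>k ^ 3 \<le> 8 ^ k\<close> turns the third moment into a binomial sum, namely
  \<open>(1 + 7 / n) ^ n\<close>.\<close>

lemma sum_cube_Bernstein_le:
  assumes "1 \<le> n"
  shows "(\<Sum>k\<le>n. real k ^ 3 * Bernstein n k (1 / real n)) \<le> exp 7"
proof -
  have x: "0 \<le> 1 / real n" "1 / real n \<le> 1" using assms by auto
  have "(\<Sum>k\<le>n. real k ^ 3 * Bernstein n k (1 / real n))
      \<le> (\<Sum>k\<le>n. 8 ^ k * Bernstein n k (1 / real n))"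
  proof (intro sum_mono mult_right_mono Bernstein_nonneg x)
    fix k
    have "real k ^ 3 \<le> (2 ^ k) ^ 3"
      by (intro power_mono) (auto simp: of_nat_less_two_power less_imp_le)
    also have "\<dots> = ((2::real) ^ 3) ^ k"
      by (metis power_mult mult.commute)
    finally show "real k ^ 3 \<le> 8 ^ k" by simp
  qed
  also have "\<dots> = (\<Sum>k\<le>n. real (n choose k) * (8 * (1 / real n)) ^ k * (1 - 1 / real n) ^ (n - k))"
    by (intro sum.cong refl) (simp add: Bernstein_def power_mult_distrib power_divide)
  also have "\<dots> = (1 + 7 / real n) ^ n"
    by (subst binomial_ring[symmetric]) (simp add: field_simps)
  also have "\<dots> \<le> exp 7"
    using exp_ge_one_plus_x_over_n_power_n[where n = n and x = 7] assms by simp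
  finally show ?thesis .
qed

text \<open>A quadratic lower bound near \<open>0\<close> extends to the whole interval at the cost of a cubic term.
  The Bernstein sum of the cubic term at the point \<open>1 / n\<close> is of order \<open>1 / n ^ 3\<close> by the moment
  estimate, so this takes care of all indices away from \<open>0\<close> at once.\<close>

lemma quadratic_lower_bound:
  fixes g :: "real \<Rightarrow> real"
  assumes bdd: "\<And>x. x \<in> {0..1} \<Longrightarrow> - M \<le> g x"
    and "0 < d" and near: "\<And>x. x \<in> {0..d} \<Longrightarrow> c * x\<^sup>2 \<le> g x"
    and "0 \<le> c"
  shows "\<exists>K\<ge>0. \<forall>x\<in>{0..1}. c * x\<^sup>2 - K * x ^ 3 \<le> g x"
proof (intro exI[of _ "(\<bar>M\<bar> + c) / d ^ 3"] conjI ballI)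
  show "0 \<le> (\<bar>M\<bar> + c) / d ^ 3" using \<open>0 < d\<close> \<open>0 \<le> c\<close> by simp
  fix x :: real assume x: "x \<in> {0..1}"
  show "c * x\<^sup>2 - (\<bar>M\<bar> + c) / d ^ 3 * x ^ 3 \<le> g x"
  proof (cases "x \<le> d")
    case True
    moreover have "0 \<le> (\<bar>M\<bar> + c) / d ^ 3 * x ^ 3" using x \<open>0 < d\<close> \<open>0 \<le> c\<close> by simp
    ultimately show ?thesis using near[of x] x by auto
  next
    case False
    then have "d ^ 3 \<le> x ^ 3" using \<open>0 < d\<close> by (intro power_mono) auto
    then have "(\<bar>M\<bar> + c) * 1 \<le> (\<bar>M\<bar> + c) * (x ^ 3 / d ^ 3)"
      using \<open>0 < d\<close> \<open>0 \<le> c\<close> by (intro mult_left_mono) auto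
    moreover have "c * x\<^sup>2 \<le> c * 1"
      using x \<open>0 \<le> c\<close> by (intro mult_left_mono) (auto simp: power_le_one)
    ultimately show ?thesis using bdd[OF x] by simp
  qed
qed

text \<open>The Bernstein sum of \<open>c * x\<^sup>2\<close> at \<open>1 / n\<close>, multiplied by \<open>n\<^sup>2\<close>, is \<open>c * (2 - 1 / n)\<close>.
  The bound corrects this at the indices \<open>1\<close> and \<open>2\<close>, where \<open>r\<close> is prescribed, and
  subtracts the cubic terms and the rounding errors of the indices from \<open>3\<close> on. Both of the
  latter are of order \<open>1 / n\<close>, because the rounding errors sum to at most \<open>2 / n ^ 3\<close> before the
  multiplication.\<close>

lemma Bernstein_at_inverse_n_lower_bound:
  fixes r :: "nat \<Rightarrow> real"
  assumes "3 \<le> n" and "0 \<le> K" and "0 \<le> c"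
    and low: "r 0 = 0" "r 1 = 0" "r 2 = 1"
    and high: "\<And>k. 3 \<le> k \<Longrightarrow> k \<le> n \<Longrightarrow>
      real (n choose k) * (c * (real k / real n)\<^sup>2 - K * (real k / real n) ^ 3) - 1 \<le> r k"
  shows "c * (2 - 1 / real n) + (1 - 3 * c * (1 - 1 / real n)) * (1 - 1 / real n) ^ (n - 2)
      - (K * exp 7 + 2) / real n
    \<le> (real n)\<^sup>2 * (\<Sum>k\<le>n. r k * (1 / real n) ^ k * (1 - 1 / real n) ^ (n - k))"
proof -
  define x where "x = 1 / real n"
  define q where "q = (1 - x) ^ (n - 2)"
  define w where "w k = x ^ k * (1 - x) ^ (n - k)" for k
  define v where "v k = Bernstein n k x" for k
  have n: "0 < real n" "real n * x = 1" and x: "0 < x" "x \<le> 1/2"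
    using \<open>3 \<le> n\<close> by (auto simp: x_def field_simps)
  have v: "v k = real (n choose k) * w k" for k
    by (simp add: v_def w_def Bernstein_def)
  have w0: "0 \<le> w k" for k unfolding w_def using x by auto
  have v0: "0 \<le> v k" for k using w0 by (simp add: v)
  have q1: "(1 - x) ^ (n - 1) = (1 - x) * q"
  proof -
    have "n - 1 = Suc (n - 2)" using \<open>3 \<le> n\<close> by simp
    then show ?thesis by (simp add: q_def)
  qed
  have v1: "v 1 = (1 - x) * q"
    using n q1 by (simp add: v_def Bernstein_def)
  have w2: "(real n)\<^sup>2 * w 2 = q"
  proof -
    have "(real n)\<^sup>2 * w 2 = (real n * x)\<^sup>2 * q"
      by (simp add: w_def q_def power_mult_distrib)
    then show ?thesis using n by simp
  qed
  have "real (n choose 2) = real n * (real n - 1) / 2"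
    using \<open>3 \<le> n\<close> by (simp add: choose_two real_of_nat_div of_nat_diff)
  then have v2: "v 2 = (1 - x) * q / 2"
  proof -
    have "v 2 = (real n * x) * (real n * x - x) * q / 2"
      by (simp add: v w_def q_def \<open>real (n choose 2) = _\<close> power2_eq_square algebra_simps)
    then show ?thesis using n by simp
  qed
  have second: "(\<Sum>k\<le>n. (real k)\<^sup>2 * v k) = 2 - x"
  proof -
    have "(\<Sum>k\<le>n. (real k)\<^sup>2 * v k)
        = (\<Sum>k\<le>n. real k * (real k - 1) * Bernstein n k x) + (\<Sum>k\<le>n. real k * Bernstein n k x)"
      unfolding v_def sum.distrib[symmetric]
      by (intro sum.cong) (auto simp: power2_eq_square algebra_simps)
    then have "(\<Sum>k\<le>n. (real k)\<^sup>2 * v k) = real n * (real n - 1) * x\<^sup>2 + real n * x"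
      by simp
    also have "\<dots> = 2 - x"
      using n by (simp add: x_def field_simps power2_eq_square)
    finally show ?thesis .
  qed
  have third: "(\<Sum>k\<le>n. real k ^ 3 * v k) \<le> exp 7"
    using sum_cube_Bernstein_le[of n] \<open>3 \<le> n\<close> by (simp add: v_def x_def)
  have rest: "(\<Sum>k=3..n. w k) \<le> 2 * x ^ 3"
  proof -
    have "w k \<le> x ^ k" for k
      unfolding w_def using x by (intro mult_left_le power_le_one) auto
    then have "(\<Sum>k=3..n. w k) \<le> (\<Sum>k=3..n. x ^ k)" by (intro sum_mono)
    moreover have "(1 - x) * (\<Sum>k=3..n. x ^ k) \<le> x ^ 3"
      using sum_gp_multiplied[of 3 n x] \<open>3 \<le> n\<close> x by simp
    moreover have "1 / 2 * (\<Sum>k=3..n. x ^ k) \<le> (1 - x) * (\<Sum>k=3..n. x ^ k)"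
      using x by (intro mult_right_mono sum_nonneg) auto
    ultimately show ?thesis by linarith
  qed
  \<comment> \<open>The summand \<open>t k\<close> is the pointwise lower bound, including the corrections at \<open>1\<close> and \<open>2\<close>.\<close>
  define t where "t k = c * x\<^sup>2 * ((real k)\<^sup>2 * v k) - K * x ^ 3 * (real k ^ 3 * v k)
      - (if 3 \<le> k then w k else 0)
      - (if k = 1 then c * x\<^sup>2 * v 1 else 0)
      - (if k = 2 then 4 * c * x\<^sup>2 * v 2 - w 2 else 0)" for k
  have t_le: "t k \<le> r k * w k" if "k \<le> n" for k
  proof -
    consider "k = 0" | "k = 1" | "k = 2" | "3 \<le> k" by linarith
    then show ?thesis
    proof cases
      case 4
      have "(real (n choose k) * (c * (real k / real n)\<^sup>2 - K * (real k / real n) ^ 3) - 1) * w k \<le> r k * w k"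
        using high[OF 4 that] w0 by (intro mult_right_mono)
      moreover have "(real (n choose k) * (c * (real k / real n)\<^sup>2 - K * (real k / real n) ^ 3) - 1) * w k = t k"
        using 4 by (simp add: t_def v x_def power_divide algebra_simps)
      ultimately show ?thesis by simp
    next
      case 2
      have "0 \<le> K * x ^ 3 * v 1" using \<open>0 \<le> K\<close> x v0 by simp
      then show ?thesis using 2 low by (simp add: t_def)
    next
      case 3
      have "0 \<le> K * x ^ 3 * (8 * v 2)" using \<open>0 \<le> K\<close> x v0 by simp
      then show ?thesis using 3 low by (simp add: t_def)
    qed (use low in \<open>simp add: t_def\<close>)
  qed
  have "(\<Sum>k\<le>n. t k) = c * x\<^sup>2 * (2 - x) - K * x ^ 3 * (\<Sum>k\<le>n. real k ^ 3 * v k)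
      - (\<Sum>k=3..n. w k) - c * x\<^sup>2 * v 1 - (4 * c * x\<^sup>2 * v 2 - w 2)"
  proof -
    have "(\<Sum>k\<le>n. if 3 \<le> k then w k else 0) = (\<Sum>k=3..n. w k)"
      by (rule sum.mono_neutral_cong_right) auto
    then show ?thesis
      unfolding t_def sum_subtractf sum_distrib_left[symmetric] second
      using \<open>3 \<le> n\<close> by (simp add: sum.delta)
  qed
  also have "\<dots> \<ge> c * x\<^sup>2 * (2 - x) - K * x ^ 3 * exp 7 - 2 * x ^ 3
      - c * x\<^sup>2 * v 1 - (4 * c * x\<^sup>2 * v 2 - w 2)"
  proof -
    have "K * x ^ 3 * (\<Sum>k\<le>n. real k ^ 3 * v k) \<le> K * x ^ 3 * exp 7"
      using third \<open>0 \<le> K\<close> x by (intro mult_left_mono) auto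
    then show ?thesis using rest by linarith
  qed
  finally have "c * x\<^sup>2 * (2 - x) - K * x ^ 3 * exp 7 - 2 * x ^ 3
      - c * x\<^sup>2 * v 1 - (4 * c * x\<^sup>2 * v 2 - w 2) \<le> (\<Sum>k\<le>n. t k)" .
  also have "\<dots> \<le> (\<Sum>k\<le>n. r k * w k)" using t_le by (intro sum_mono) auto
  finally have "(real n)\<^sup>2 * (c * x\<^sup>2 * (2 - x) - K * x ^ 3 * exp 7 - 2 * x ^ 3
      - c * x\<^sup>2 * v 1 - (4 * c * x\<^sup>2 * v 2 - w 2)) \<le> (real n)\<^sup>2 * (\<Sum>k\<le>n. r k * w k)"
    by (intro mult_left_mono) auto
  moreover have "(real n)\<^sup>2 * (c * x\<^sup>2 * (2 - x) - K * x ^ 3 * exp 7 - 2 * x ^ 3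
      - c * x\<^sup>2 * v 1 - (4 * c * x\<^sup>2 * v 2 - w 2))
    = c * (2 - x) + (1 - 3 * c * (1 - x)) * q - (K * exp 7 + 2) * x"
  proof -
    have "(real n)\<^sup>2 * (c * x\<^sup>2 * (2 - x) - K * x ^ 3 * exp 7 - 2 * x ^ 3
        - c * x\<^sup>2 * v 1 - (4 * c * x\<^sup>2 * v 2 - w 2))
      = (real n * x)\<^sup>2 * (c * (2 - x) - (K * exp 7 + 2) * x - c * v 1 - 4 * c * v 2) + (real n)\<^sup>2 * w 2"
      by (simp add: algebra_simps power2_eq_square power3_eq_cube)
    also have "\<dots> = c * (2 - x) - (K * exp 7 + 2) * x - c * ((1 - x) * q) - 4 * c * ((1 - x) * q / 2) + q"
      unfolding n(2) v1 v2 w2 by simp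
    also have "\<dots> = c * (2 - x) + (1 - 3 * c * (1 - x)) * q - (K * exp 7 + 2) * x"
      by algebra
    finally show ?thesis .
  qed
  ultimately show ?thesis by (simp add: x_def q_def w_def mult.assoc)
qed

text \<open>At \<open>x = 1 / n\<close> rounding is visible at the scale \<open>x\<^sup>2\<close>. If \<open>g x\<close> behaves like \<open>x\<^sup>2\<close>
  near \<open>0\<close> and the coefficients are those of \<open>g\<close> rounded down, but with \<open>0, 0, 1\<close> as the first three,
  then \<open>n\<^sup>2\<close> times the value at \<open>1 / n\<close> is asymptotically at least \<open>2 - 2 / exp 1\<close>, which
  exceeds the limit \<open>1\<close> that a good approximation would give.

  Such a sequence does occur: for \<open>f x = x\<^sup>2\<close> the second derivatives at the point \<open>0\<close>
  itself do converge, and only the neighbouring points of order \<open>1 / n\<close> show that the convergence is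
  not uniform.\<close>

lemma no_unit_quadratic_start:
  fixes g :: "real \<Rightarrow> real" and r :: "nat \<Rightarrow> nat \<Rightarrow> real"
  assumes r_ge: "\<And>n k. 3 \<le> k \<Longrightarrow> k \<le> n \<Longrightarrow> real (n choose k) * g (real k / real n) - 1 \<le> r n k"
    and low: "\<forall>\<^sub>F n in sequentially. r n 0 = 0 \<and> r n 1 = 0 \<and> r n 2 = 1"
    and bdd: "\<And>x. x \<in> {0..1} \<Longrightarrow> - M \<le> g x"
    and near: "\<And>c. c < 1 \<Longrightarrow> \<exists>d>0. \<forall>x\<in>{0..d}. c * x\<^sup>2 \<le> g x"
    and lim: "(\<lambda>n. (real n)\<^sup>2 * poly (bernstein_form n (r n)) (1 / real n)) \<longlonglongrightarrow> 1"
  shows False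
proof -
  \<comment> \<open>The margin is \<open>2 - 2 / exp 1 - 1 > 1 / 5\<close>, and replacing \<open>1\<close> by \<open>c\<close> costs at most \<open>2 * (1 - c)\<close>.\<close>
  define c :: real where "c = 19 / 20"
  obtain d where "0 < d" "\<And>x. x \<in> {0..d} \<Longrightarrow> c * x\<^sup>2 \<le> g x"
    using near[of c] by (auto simp: c_def)
  from quadratic_lower_bound[OF bdd this] obtain K
    where K: "0 \<le> K" "\<And>x. x \<in> {0..1} \<Longrightarrow> c * x\<^sup>2 - K * x ^ 3 \<le> g x"
    by (auto simp: c_def)
  define L where "L n = c * (2 - 1 / real n)
      + (1 - 3 * c * (1 - 1 / real n)) * ((1 - 1 / real n) ^ n / (1 - 1 / real n)\<^sup>2)
      - (K * exp 7 + 2) / real n" for n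
  have "L \<longlonglongrightarrow> c * (2 - 0) + (1 - 3 * c * (1 - 0)) * (exp (-1) / (1 - 0)\<^sup>2) - 0"
    unfolding L_def
    using tendsto_exp_limit_sequentially[of "-1"]
    by (intro tendsto_intros lim_const_over_n lim_1_over_n) auto
  moreover have "\<forall>\<^sub>F n in sequentially. L n \<le> (real n)\<^sup>2 * poly (bernstein_form n (r n)) (1 / real n)"
    using low eventually_ge_at_top[of 3]
  proof eventually_elim
    case (elim n)
    have "real (n choose k) * (c * (real k / real n)\<^sup>2 - K * (real k / real n) ^ 3) - 1 \<le> r n k"
      if "3 \<le> k" "k \<le> n" for k
    proof -
      have "real (n choose k) * (c * (real k / real n)\<^sup>2 - K * (real k / real n) ^ 3)
          \<le> real (n choose k) * g (real k / real n)"
        using that by (intro mult_left_mono K) auto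
      then show ?thesis using r_ge[OF that] by linarith
    qed
    from Bernstein_at_inverse_n_lower_bound[OF _ K(1) _ _ _ _ this]
    have "c * (2 - 1 / real n) + (1 - 3 * c * (1 - 1 / real n)) * (1 - 1 / real n) ^ (n - 2)
      - (K * exp 7 + 2) / real n \<le> (real n)\<^sup>2 * poly (bernstein_form n (r n)) (1 / real n)"
      using elim by (simp add: poly_bernstein_form c_def)
    moreover have "(1 - 1 / real n) ^ (n - 2) = (1 - 1 / real n) ^ n / (1 - 1 / real n)\<^sup>2"
      using elim by (intro power_diff) auto
    ultimately show ?case by (simp only: L_def)
  qed
  ultimately have "c * (2 - 0) + (1 - 3 * c * (1 - 0)) * (exp (-1) / (1 - 0)\<^sup>2) - 0 \<le> 1"
    using lim by (intro tendsto_le[of sequentially]) auto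
  moreover have "exp (-1) \<le> (2/5 :: real)"
  proof -
    have "(5/2 :: real) \<le> exp 1" using exp_lower_Taylor_quadratic[of 1] by simp
    then show ?thesis by (simp add: exp_minus inverse_eq_divide divide_le_eq)
  qed
  ultimately show False by (simp add: c_def)
qed

section \<open>The left endpoint\<close>

lemma coeff_tendsto_of_derivative_at_zero:
  fixes p :: "nat \<Rightarrow> real poly"
  assumes "(\<lambda>n. poly ((pderiv ^^ i) (p n)) 0 - L) \<longlonglongrightarrow> 0"
  shows "(\<lambda>n. coeff (p n) i) \<longlonglongrightarrow> L / fact i"
proof -
  have "poly ((pderiv ^^ i) q) 0 = fact i * coeff q i" for q :: "real poly"
    by (simp add: poly_0_coeff_0 coeff_higher_pderiv pochhammer_fact)
  then have "(\<lambda>n. coeff (p n) i) = (\<lambda>n. (poly ((pderiv ^^ i) (p n)) 0 - L + L) / fact i)"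
    by simp
  also have "\<dots> \<longlonglongrightarrow> (0 + L) / fact i"
    by (intro tendsto_intros assms) auto
  finally show ?thesis by simp
qed

text \<open>By the absorption identity \<open>k * (n choose k) = n * (n - 1 choose k - 1)\<close>.\<close>

lemma binomial_affine_Ints:
  assumes "c \<in> \<int>" "d \<in> \<int>" "1 \<le> k" "1 \<le> n"
  shows "real (n choose k) * (c + d * (real k / real n)) \<in> \<int>"
proof -
  have "real k * real (n choose k) = real n * real ((n - 1) choose (k - 1))"
    using times_binomial_minus1_eq[of k n] \<open>1 \<le> k\<close> by (metis less_eq_Suc_le One_nat_def of_nat_mult)
  then have "real (n choose k) * (real k / real n) = real ((n - 1) choose (k - 1))"
    using \<open>1 \<le> n\<close> by (simp add: field_simps)
  then have "real (n choose k) * (c + d * (real k / real n))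
      = real (n choose k) * c + d * real ((n - 1) choose (k - 1))"
    by (metis distrib_left mult.left_commute)
  also have "\<dots> \<in> \<int>" using assms by auto
  finally show ?thesis .
qed

text \<open>Here \<open>r n k\<close> is the difference between the \<open>k\<close>-th coefficient of the integer Bernstein polynomial
  and that of the tangent \<open>c + d * x\<close> of \<open>D 0\<close> at \<open>0\<close>. The goal is that for each \<open>k \<le> s\<close> it vanishes
  for large \<open>n\<close>: the rounded coefficient then agrees with that of the tangent, and rounding down
  only decreases values, which is the asserted inequality.

  If \<open>r n j\<close> vanishes for all \<open>j < k\<close>, then \<open>r n k\<close> is the coefficient of \<open>x ^ k\<close>
  in the difference, so it converges to \<open>\<gamma> = D k 0 / fact k\<close> when \<open>k \<ge> 2\<close>. Being an integer it is
  eventually equal to \<open>\<gamma>\<close>. On the other hand, the tangent having integer coefficients, it is obtained by rounding down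
  \<open>(n choose k) * g (k / n)\<close>, which by Taylor's formula tends to \<open>\<gamma> * k ^ k / fact k\<close>. Rounding
  changes a number by at most one, whereas the factor \<open>k ^ k / fact k\<close> is at least \<open>2\<close>; this leaves
  \<open>\<gamma> = 0\<close> and the single exception \<open>k = 2\<close>, \<open>\<gamma> = 1\<close>, which is excluded
  by looking at the points \<open>1 / n\<close>.\<close>

lemma affine_contact_at_zero:
  fixes D :: "nat \<Rightarrow> real \<Rightarrow> real" and p :: "nat \<Rightarrow> real poly"
  assumes "1 \<le> s"
    and der: "\<And>i x. i < s \<Longrightarrow> x \<in> {0..1} \<Longrightarrow>
      (D i has_real_derivative D (Suc i) x) (at x within {0..1})"
    and cont: "continuous_on {0..1} (D s)"
    and p: "\<And>n x. 1 \<le> n \<Longrightarrow> poly (p n) x = int_bernstein n (D 0) x"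
    and pw: "\<And>x. x \<in> {0..1} \<Longrightarrow> (\<lambda>n. poly (p n) x) \<longlonglongrightarrow> D 0 x"
    and unif: "\<And>n x. x \<in> {0..1} \<Longrightarrow> \<bar>poly ((pderiv ^^ s) (p n)) x - D s x\<bar> \<le> e n"
    and e: "e \<longlonglongrightarrow> 0"
  shows "\<forall>i\<in>{2..s}. D i 0 = 0"
    and "\<forall>\<^sub>F n in sequentially. \<forall>k\<in>{1..s}.
      D 0 0 + real k / real n * D 1 0 \<le> D 0 (real k / real n)"
proof -
  define c where "c = D 0 0"
  define d where "d = D 1 0"
  define g where "g x = D 0 x - (c + d * x)" for x
  define a where "a n k = real_of_int \<lfloor>D 0 (real k / real n) * real (n choose k)\<rfloor>" for n k
  define r where "r n k = a n k - real (n choose k) * (c + d * (real k / real n))" for n k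
  define H where "H n i x = poly ((pderiv ^^ i) (p n)) x - D i x" for n i x
  have H_der: "(H n i has_real_derivative H n (Suc i) x) (at x within {0..1})"
    if "i < s" "x \<in> {0..1}" for n i x
    unfolding H_def
    by (intro DERIV_diff der[OF that]) (simp add: has_field_derivative_at_within poly_DERIV)
  have H_lim: "(\<lambda>n. H n i 0) \<longlonglongrightarrow> 0" if "i \<le> s" for i
  proof (rule Taylor_coefficients_tendsto_zero[where H = H and s = s and e = e])
    show "(\<lambda>n. H n 0 x) \<longlonglongrightarrow> 0" if "x \<in> {0..1}" for x
      using tendsto_diff[OF pw[OF that] tendsto_const[of "D 0 x"]] by (simp add: H_def)
    show "\<bar>H n s x\<bar> \<le> e n" if "x \<in> {0..1}" for n x
      using unif[OF that] by (simp add: H_def)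
  qed (use \<open>1 \<le> s\<close> H_der e that in auto)
  have p_lim: "(\<lambda>n. coeff (p n) i) \<longlonglongrightarrow> D i 0 / fact i" if "i \<le> s" for i
    using H_lim[OF that] unfolding H_def by (rule coeff_tendsto_of_derivative_at_zero)
  have form: "bernstein_form n (r n) = p n - [:c, d:]" if "1 \<le> n" for n
  proof -
    have "poly (bernstein_form n (a n)) x = poly (p n) x" for x
      using p[OF that] by (simp add: poly_bernstein_form int_bernstein_def a_def atLeast0AtMost)
    then have "bernstein_form n (a n) = p n"
      by (intro poly_eq_poly_eq_iff[THEN iffD1] ext)
    then show ?thesis
      unfolding r_def bernstein_form_diff by (simp only: bernstein_form_affine[OF that])
  qed
  have r_lim: "(\<lambda>n. r n k) \<longlonglongrightarrow> (if k \<le> 1 then 0 else D k 0 / fact k)"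
    if "k \<le> s" and zero: "\<And>j. j < k \<Longrightarrow> \<forall>\<^sub>F n in sequentially. r n j = 0" for k
  proof (rule Lim_transform_eventually)
    have "(\<lambda>n. coeff (p n) k - coeff [:c, d:] k) \<longlonglongrightarrow> D k 0 / fact k - coeff [:c, d:] k"
      by (intro tendsto_intros p_lim that)
    also have "D k 0 / fact k - coeff [:c, d:] k = (if k \<le> 1 then 0 else D k 0 / fact k)"
      by (auto simp: c_def d_def coeff_pCons split: nat.split)
    finally show "(\<lambda>n. coeff (p n) k - coeff [:c, d:] k) \<longlonglongrightarrow> (if k \<le> 1 then 0 else D k 0 / fact k)" .
    have "\<forall>\<^sub>F n in sequentially. \<forall>j\<in>{..<k}. r n j = 0"
      using zero by (intro eventually_ball_finite) auto
    then show "\<forall>\<^sub>F n in sequentially. coeff (p n) k - coeff [:c, d:] k = r n k"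
      using eventually_ge_at_top[of "max 1 k"]
    proof eventually_elim
      case (elim n)
      then have "r n k = coeff (bernstein_form n (r n)) k"
        by (intro coeff_bernstein_form_first[symmetric]) auto
      then show ?case using form[of n] elim by simp
    qed
  qed
  have floor: "r n k \<le> real (n choose k) * g (real k / real n)"
      "real (n choose k) * g (real k / real n) \<le> r n k + 1" for n k
    unfolding r_def a_def g_def by (simp_all add: algebra_simps) linarith+
  \<comment> \<open>The coefficient of index \<open>0\<close> does not depend on \<open>n\<close>, so its limit \<open>0\<close> is its value.\<close>
  have r0: "r n 0 = 0" for n
  proof -
    have "(\<lambda>n. r n 0) \<longlonglongrightarrow> 0" using r_lim[of 0] by simp
    then show ?thesis by (simp add: r_def a_def LIMSEQ_const_iff)
  qed
  have c_int: "c \<in> \<int>"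
  proof -
    have "real_of_int \<lfloor>c\<rfloor> = c" using r0[of 0] by (simp add: r_def a_def c_def)
    then show ?thesis by (metis Ints_of_int)
  qed
  have a1: "a n 1 - real n * c = r n 1 + d" if "1 \<le> n" for n
    using that by (simp add: r_def algebra_simps)
  have "(\<lambda>n. r n 1) \<longlonglongrightarrow> 0" using r_lim[of 1] r0 \<open>1 \<le> s\<close> by simp
  then have "(\<lambda>n. r n 1 + d) \<longlonglongrightarrow> 0 + d" by (intro tendsto_intros)
  then have "(\<lambda>n. r n 1 + d) \<longlonglongrightarrow> d" by simp
  moreover have "\<forall>\<^sub>F n in sequentially. r n 1 + d \<in> \<int>"
    using eventually_ge_at_top[of 1]
  proof eventually_elim
    case (elim n)
    have "a n 1 - real n * c \<in> \<int>" using c_int by (auto simp: a_def)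
    then show ?case using a1[OF elim] by simp
  qed
  ultimately have d_int: "d \<in> \<int>" and "\<forall>\<^sub>F n in sequentially. r n 1 + d = d"
    by (auto dest: Ints_tendsto_eventually_eq)
  then have r1: "\<forall>\<^sub>F n in sequentially. r n 1 = 0" by simp
  have key: "(\<forall>\<^sub>F n in sequentially. r n k = 0) \<and> (2 \<le> k \<longrightarrow> D k 0 = 0)" if "k \<le> s" for k
    using that
  proof (induction k rule: less_induct)
    case (less k)
    show ?case
    proof (cases "2 \<le> k")
      case False
      then have "k = 0 \<or> k = 1" by auto
      then show ?thesis using r0 r1 by auto
    next
      case True
      define \<gamma> where "\<gamma> = D k 0 / fact k"
      define \<kappa> where "\<kappa> = real k ^ k / fact k"
      have lim: "(\<lambda>n. r n k) \<longlonglongrightarrow> \<gamma>"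
        using r_lim[OF less.prems] less True by (simp add: \<gamma>_def)
      moreover have "\<forall>\<^sub>F n in sequentially. r n k \<in> \<int>"
        using eventually_ge_at_top[of 1]
      proof eventually_elim
        case (elim n)
        then show ?case
          unfolding r_def using True
          by (intro Ints_diff binomial_affine_Ints c_int d_int) (auto simp: a_def)
      qed
      ultimately have \<gamma>_int: "\<gamma> \<in> \<int>" and r_eq: "\<forall>\<^sub>F n in sequentially. r n k = \<gamma>"
        by (auto dest: Ints_tendsto_eventually_eq)
      have g_lim: "((\<lambda>x. g x / x ^ k) \<longlongrightarrow> \<gamma>) (at_right 0)"
      proof -
        have "continuous_on {0..1} (D k)"
        proof (cases "k = s")
          case False
          then show ?thesis using less.prems der by (intro DERIV_continuous_on[of _ _ "D (Suc k)"]) auto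
        qed (use cont in simp)
        then have "((\<lambda>x. (D 0 x - (\<Sum>i<k. D i 0 / fact i * x ^ i)) / x ^ k) \<longlongrightarrow> \<gamma>) (at_right 0)"
          unfolding \<gamma>_def using der less.prems True
          by (intro Taylor_Peano_at_zero[where D = D and k = k]) auto
        moreover have "(\<Sum>i<k. D i 0 / fact i * x ^ i) = c + d * x" for x
        proof -
          have "{..<k} = {0, 1} \<union> {2..<k}" using True by auto
          then have "(\<Sum>i<k. D i 0 / fact i * x ^ i) = c + d * x + (\<Sum>i\<in>{2..<k}. D i 0 / fact i * x ^ i)"
            by (simp add: sum.union_disjoint c_def d_def)
          also have "(\<Sum>i\<in>{2..<k}. D i 0 / fact i * x ^ i) = 0"
            using less by (intro sum.neutral) auto
          finally show ?thesis by simp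
        qed
        ultimately show ?thesis by (simp add: g_def)
      qed
      have g_seq: "(\<lambda>n. g (real m / real n) / (real m / real n) ^ k) \<longlonglongrightarrow> \<gamma>" if "1 \<le> m" for m
      proof (rule filterlim_compose[OF g_lim])
        show "filterlim (\<lambda>n. real m / real n) (at_right 0) sequentially"
        proof (rule tendsto_imp_filterlim_at_right)
          show "\<forall>\<^sub>F n in sequentially. 0 < real m / real n"
            using eventually_gt_at_top[of 0] by eventually_elim (use that in auto)
        qed (rule lim_const_over_n)
      qed
      have "(\<lambda>n. real (n choose k) / real n ^ k * (real k ^ k * (g (real k / real n) / (real k / real n) ^ k)))
          \<longlonglongrightarrow> 1 / fact k * (real k ^ k * \<gamma>)"
        using True by (intro tendsto_intros binomial_over_power_tendsto g_seq) auto
      moreover have "\<forall>\<^sub>F n in sequentially. real (n choose k) / real n ^ k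
            * (real k ^ k * (g (real k / real n) / (real k / real n) ^ k))
          = real (n choose k) * g (real k / real n)"
        using eventually_gt_at_top[of 0]
        by eventually_elim (use True in \<open>simp add: power_divide\<close>)
      ultimately have "(\<lambda>n. real (n choose k) * g (real k / real n)) \<longlonglongrightarrow> 1 / fact k * (real k ^ k * \<gamma>)"
        by (rule Lim_transform_eventually)
      then have Cg: "(\<lambda>n. real (n choose k) * g (real k / real n)) \<longlonglongrightarrow> \<kappa> * \<gamma>"
        by (simp add: \<kappa>_def)
      have low: "\<gamma> \<le> \<kappa> * \<gamma>"
      proof (rule tendsto_lowerbound[OF Cg])
        show "\<forall>\<^sub>F n in sequentially. \<gamma> \<le> real (n choose k) * g (real k / real n)"
          using r_eq by eventually_elim (metis floor(1))
      qed simp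
      have high: "\<kappa> * \<gamma> \<le> \<gamma> + 1"
      proof (rule tendsto_upperbound[OF Cg])
        show "\<forall>\<^sub>F n in sequentially. real (n choose k) * g (real k / real n) \<le> \<gamma> + 1"
          using r_eq by eventually_elim (metis floor(2))
      qed simp
      have \<kappa>: "\<kappa> = 2" if "k = 2"
        using that by (simp add: \<kappa>_def)
      have \<kappa>3: "2 < \<kappa>" if "k \<noteq> 2"
        using two_fact_less_self_power[of k] that True by (simp add: \<kappa>_def less_divide_eq)
      have "\<gamma> = 0"
      proof (rule ccontr)
        assume "\<gamma> \<noteq> 0"
        have "0 \<le> (\<kappa> - 1) * \<gamma>" using low by (simp add: left_diff_distrib)
        moreover have "0 < \<kappa> - 1" using \<kappa> \<kappa>3 by (cases "k = 2") auto
        ultimately have "0 \<le> \<gamma>" by (simp add: zero_le_mult_iff)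
        then have "1 \<le> \<gamma>" using \<gamma>_int \<open>\<gamma> \<noteq> 0\<close> by (auto elim!: Ints_cases)
        have "(\<kappa> - 1) * 1 \<le> (\<kappa> - 1) * \<gamma>"
          using \<open>1 \<le> \<gamma>\<close> \<open>0 < \<kappa> - 1\<close> by (intro mult_left_mono) auto
        also have "\<dots> \<le> 1" using high by (simp add: left_diff_distrib)
        finally have "\<kappa> \<le> 2" by simp
        then have "k = 2" using \<kappa>3 by force
        then have "\<gamma> = 1" using \<open>1 \<le> \<gamma>\<close> high \<kappa> by simp
        \<comment> \<open>The exceptional case, in which \<open>g\<close> behaves like \<open>x\<^sup>2\<close> near \<open>0\<close>.\<close>
        have "2 \<le> s" using less.prems True by simp
        have "continuous_on {0..1} (D 0)"
          using der \<open>1 \<le> s\<close> by (intro DERIV_continuous_on[of _ _ "D 1"]) auto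
        then have "continuous_on {0..1} g"
          unfolding g_def by (intro continuous_intros)
        then have "compact (g ` {0..1})"
          by (rule compact_continuous_image) simp
        then obtain M where M: "\<And>x. x \<in> {0..1} \<Longrightarrow> \<bar>g x\<bar> \<le> M"
          by (metis bounded_real compact_imp_bounded imageI)
        show False
        proof (rule no_unit_quadratic_start[of g r])
          show "real (n choose k) * g (real k / real n) - 1 \<le> r n k" for n k
            using floor(2)[of n k] by simp
          show "\<forall>\<^sub>F n in sequentially. r n 0 = 0 \<and> r n 1 = 0 \<and> r n 2 = 1"
            using r1 r_eq by eventually_elim (use r0 \<open>k = 2\<close> \<open>\<gamma> = 1\<close> in auto)
          show "- M \<le> g x" if "x \<in> {0..1}" for x using M[OF that] by linarith
          show "\<exists>b>0. \<forall>x\<in>{0..b}. c' * x\<^sup>2 \<le> g x" if "c' < 1" for c'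
          proof -
            have "\<forall>\<^sub>F x in at_right 0. c' < g x / x ^ k"
              using g_lim that \<open>\<gamma> = 1\<close> by (intro order_tendstoD) auto
            then obtain b where b: "0 < b" "\<And>x. 0 < x \<Longrightarrow> x < b \<Longrightarrow> c' < g x / x\<^sup>2"
              by (auto simp: eventually_at_right_field \<open>k = 2\<close>)
            have "c' * x\<^sup>2 \<le> g x" if "x \<in> {0..b / 2}" for x
            proof (cases "x = 0")
              case True
              then show ?thesis by (simp add: g_def c_def)
            next
              case False
              then show ?thesis using b(2)[of x] that b(1) by (simp add: less_divide_eq)
            qed
            then show ?thesis using b(1) by (intro exI[of _ "b / 2"]) auto
          qed
          have "\<forall>\<^sub>F n in sequentially. H n 0 0 = 0 \<and> H n 1 0 = 0"
            using r1 eventually_ge_at_top[of 1]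
          proof eventually_elim
            case (elim n)
            have "coeff (bernstein_form n (r n)) 0 = 0" "coeff (bernstein_form n (r n)) 1 = 0"
              using coeff_bernstein_form_first[of 0 "r n" n] coeff_bernstein_form_first[of 1 "r n" n] elim r0
              by auto
            then have "coeff (p n) 0 = c" "coeff (p n) 1 = d"
              using form[of n] elim by simp_all
            then show ?case
              by (simp add: H_def poly_0_coeff_0 coeff_pderiv c_def d_def)
          qed
          moreover have "\<forall>\<^sub>F n in sequentially. 1 / real n \<in> {0<..1}"
            using eventually_ge_at_top[of 1] by eventually_elim auto
          ultimately have "(\<lambda>n. H n 0 (1 / real n) / (1 / real n)\<^sup>2) \<longlonglongrightarrow> 0"
            using unif e
            by (intro quadratic_error_tendsto_zero[where H = H and s = s and e = e] H_der H_lim \<open>2 \<le> s\<close>)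
              (auto simp: H_def)
          from tendsto_add[OF this g_seq[of 1]]
          have "(\<lambda>n. H n 0 (1 / real n) / (1 / real n)\<^sup>2 + g (1 / real n) / (1 / real n)\<^sup>2) \<longlonglongrightarrow> 1"
            by (simp add: \<open>k = 2\<close> \<open>\<gamma> = 1\<close>)
          moreover have "\<forall>\<^sub>F n in sequentially.
              H n 0 (1 / real n) / (1 / real n)\<^sup>2 + g (1 / real n) / (1 / real n)\<^sup>2
              = (real n)\<^sup>2 * poly (bernstein_form n (r n)) (1 / real n)"
            using eventually_ge_at_top[of 1]
          proof eventually_elim
            case (elim n)
            have "poly (bernstein_form n (r n)) (1 / real n) = H n 0 (1 / real n) + g (1 / real n)"
              by (simp add: form[OF elim] H_def g_def)
            then show ?case by (simp add: power_divide field_simps)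
          qed
          ultimately show "(\<lambda>n. (real n)\<^sup>2 * poly (bernstein_form n (r n)) (1 / real n)) \<longlonglongrightarrow> 1"
            by (rule Lim_transform_eventually)
        qed
      qed
      then show ?thesis using r_eq True by (simp add: \<gamma>_def)
    qed
  qed
  show "\<forall>i\<in>{2..s}. D i 0 = 0" using key by auto
  have "\<forall>\<^sub>F n in sequentially. \<forall>k\<in>{1..s}. r n k = 0"
    using key by (intro eventually_ball_finite) auto
  then show "\<forall>\<^sub>F n in sequentially. \<forall>k\<in>{1..s}.
      D 0 0 + real k / real n * D 1 0 \<le> D 0 (real k / real n)"
    using eventually_ge_at_top[of s]
  proof eventually_elim
    case (elim n)
    show ?case
    proof
      fix k assume k: "k \<in> {1..s}"
      have "0 \<le> real (n choose k) * g (real k / real n)"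
        using floor(1)[of n k] elim(1) k by simp
      moreover have "0 < n choose k" using k elim(2) by (intro zero_less_binomial) auto
      ultimately have "0 \<le> g (real k / real n)" by (simp add: zero_le_mult_iff)
      then show "D 0 0 + real k / real n * D 1 0 \<le> D 0 (real k / real n)"
        by (simp add: g_def c_def d_def mult.commute)
    qed
  qed
qed

section \<open>Derivatives and reflection on the unit interval\<close>

lemma C_on01_has_derivative:
  assumes "C_on01 s f" "i < s" "x \<in> {0..1}"
  shows "(deriv01 i f has_real_derivative deriv01 (Suc i) f x) (at x within {0..1})"
proof -
  have "deriv01 i f differentiable (at x within {0..1})"
    using assms by (auto simp: C_on01_def differentiable_on_def)
  then show ?thesis
    by (simp add: vector_derivative_works has_real_derivative_iff_has_vector_derivative deriv01_def)
qed

lemma deriv01_poly: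
  assumes "x \<in> {0..1}"
  shows "deriv01 i (poly p) x = poly ((pderiv ^^ i) p) x"
  using assms
proof (induction i arbitrary: x)
  case 0
  then show ?case by (simp add: deriv01_def)
next
  case (Suc i)
  have "(poly ((pderiv ^^ i) p) has_vector_derivative poly ((pderiv ^^ Suc i) p) x) (at x within {0..1})"
    by (simp add: has_real_derivative_iff_has_vector_derivative[symmetric]
        has_field_derivative_at_within poly_DERIV)
  then have "(deriv01 i (poly p) has_vector_derivative poly ((pderiv ^^ Suc i) p) x) (at x within {0..1})"
    by (rule has_vector_derivative_transform[OF Suc.prems, rotated]) (use Suc.IH in auto)
  from vector_derivative_within_closed_interval[OF _ _ this] Suc.prems
  show ?case by (simp add: deriv01_def)
qed

lemma abs_le_sup_norm01:
  assumes "continuous_on {0..1} g" "x \<in> {0..1}"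
  shows "\<bar>g x\<bar> \<le> sup_norm01 g"
  unfolding sup_norm01_def
proof (rule cSUP_upper[OF assms(2)])
  have "compact ((\<lambda>x. \<bar>g x\<bar>) ` {0..1})"
    by (intro compact_continuous_image continuous_intros assms(1)) auto
  then show "bdd_above ((\<lambda>x. \<bar>g x\<bar>) ` {0..1})"
    by (intro bounded_imp_bdd_above compact_imp_bounded)
qed

lemma higher_pderiv_pcompose_reflect:
  fixes p :: "real poly"
  shows "(pderiv ^^ i) (pcompose p [:1, -1:]) = smult ((-1) ^ i) (pcompose ((pderiv ^^ i) p) [:1, -1:])"
  by (induction i) (simp_all add: pderiv_smult pderiv_pcompose pderiv_pCons)

text \<open>For \<open>n = 0\<close> this fails in general: division by zero makes the operator evaluate its argument at \<open>0\<close>,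
  on either side of the reflection.\<close>

lemma int_bernstein_reflect:
  assumes "1 \<le> n"
  shows "int_bernstein n (\<lambda>x. f (1 - x)) x = int_bernstein n f (1 - x)"
  unfolding int_bernstein_def
proof (subst sum.atLeastAtMost_rev, unfold add_0_right, intro sum.cong refl)
  fix k assume "k \<in> {0..n}"
  then have "k \<le> n" by simp
  then have "1 - real (n - k) / real n = real k / real n"
    using assms by (simp add: of_nat_diff field_simps)
  then show "real_of_int \<lfloor>f (1 - real (n - k) / real n) * real (n choose (n - k))\<rfloor> *
      x ^ (n - k) * (1 - x) ^ (n - (n - k)) =
    real_of_int \<lfloor>f (real k / real n) * real (n choose k)\<rfloor> * (1 - x) ^ k * (1 - (1 - x)) ^ (n - k)"
    using \<open>k \<le> n\<close> by (simp add: binomial_symmetric[symmetric])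
qed

theorem theorem3p2:
  fixes s :: nat and f :: "real \<Rightarrow> real"
  assumes "s \<ge> 1"
    and "C_on01 s f"
    and "(\<lambda>n. sup_norm01 (\<lambda>x. int_bernstein n f x - f x)) \<longlonglongrightarrow> 0"
    and "(\<lambda>n. sup_norm01 (\<lambda>x. deriv01 s (int_bernstein n f) x - deriv01 s f x)) \<longlonglongrightarrow> 0"
  shows "(\<forall>i\<in>{2..s}. deriv01 i f 0 = 0 \<and> deriv01 i f 1 = 0) \<and>
    (\<exists>n0::nat. n0 \<ge> 1 \<and> n0 \<ge> s \<and>
      (\<forall>n\<ge>n0. \<forall>k\<in>{1..s}.
         f (real k / real n) \<ge> f 0 + real k / real n * deriv01 1 f 0) \<and>
      (\<forall>n\<ge>n0. \<forall>k\<in>{n - s..n - 1}.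
         f (real k / real n) \<ge> f 1 - (1 - real k / real n) * deriv01 1 f 1))"
proof -
  define D where "D i = deriv01 i f" for i
  define p where "p n = bernstein_form n (\<lambda>k. real_of_int \<lfloor>f (real k / real n) * real (n choose k)\<rfloor>)" for n
  define e where "e n = sup_norm01 (\<lambda>x. deriv01 s (int_bernstein n f) x - deriv01 s f x)" for n
  have D0: "D 0 = f" by (simp add: D_def deriv01_def)
  have der: "(D i has_real_derivative D (Suc i) x) (at x within {0..1})"
    if "i < s" "x \<in> {0..1}" for i x
    unfolding D_def using C_on01_has_derivative[OF assms(2) that] .
  have cont: "continuous_on {0..1} (D s)"
    using assms(2) by (simp add: C_on01_def D_def)
  have p: "int_bernstein n f = poly (p n)" for n
    by (auto simp: p_def poly_bernstein_form int_bernstein_def atLeast0AtMost)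
  have pw: "(\<lambda>n. poly (p n) x) \<longlonglongrightarrow> D 0 x" if x: "x \<in> {0..1}" for x
  proof -
    have "continuous_on {0..1} f"
      using der[of 0] \<open>s \<ge> 1\<close> unfolding D0 by (intro DERIV_continuous_on[of _ _ "D 1"]) auto
    then have "\<bar>poly (p n) x - f x\<bar> \<le> sup_norm01 (\<lambda>x. int_bernstein n f x - f x)" for n
      unfolding p using x by (intro abs_le_sup_norm01 continuous_intros)
    then have "(\<lambda>n. poly (p n) x - f x) \<longlonglongrightarrow> 0"
      by (intro Lim_null_comparison[OF _ assms(3)]) auto
    then show ?thesis by (simp add: D0 LIM_zero_iff)
  qed
  have unif: "\<bar>poly ((pderiv ^^ s) (p n)) x - D s x\<bar> \<le> e n" if x: "x \<in> {0..1}" for n x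
  proof -
    have "continuous_on {0..1} (\<lambda>x. poly ((pderiv ^^ s) (p n)) x - D s x)"
      by (intro continuous_intros cont)
    then have "continuous_on {0..1} (\<lambda>x. deriv01 s (int_bernstein n f) x - deriv01 s f x)"
      by (rule continuous_on_eq) (simp add: p deriv01_poly D_def)
    from abs_le_sup_norm01[OF this x] show ?thesis
      using x by (simp add: e_def p deriv01_poly D_def)
  qed
  have e: "e \<longlonglongrightarrow> 0" using assms(4) by (simp add: e_def[abs_def])
  \<comment> \<open>The right endpoint is the left endpoint of the function \<open>f (1 - x)\<close>.\<close>
  define D' where "D' i x = (-1) ^ i * D i (1 - x)" for i x
  define p' where "p' n = pcompose (p n) [:1, -1:]" for n
  have left: "\<forall>i\<in>{2..s}. D i 0 = 0"
    "\<forall>\<^sub>F n in sequentially. \<forall>k\<in>{1..s}. D 0 0 + real k / real n * D 1 0 \<le> D 0 (real k / real n)"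
    by (rule affine_contact_at_zero[of s D p e, OF \<open>s \<ge> 1\<close> der cont _ pw unif e]; simp add: D0 p)+
  have der': "(D' i has_real_derivative D' (Suc i) x) (at x within {0..1})"
    if "i < s" "x \<in> {0..1}" for i x
  proof -
    have "(D i has_real_derivative D (Suc i) (1 - x)) (at (1 - x) within (\<lambda>x. 1 - x) ` {0..1})"
      using der[OF that(1), of "1 - x"] that(2) by simp
    moreover have "((\<lambda>x. 1 - x) has_real_derivative - 1) (at x within {0..1})"
      by (auto intro!: derivative_eq_intros)
    ultimately have "(D i \<circ> (\<lambda>x. 1 - x) has_real_derivative D (Suc i) (1 - x) * - 1) (at x within {0..1})"
      by (rule DERIV_image_chain)
    from DERIV_cmult[OF this, of "(-1) ^ i"] show ?thesis
      by (simp add: D'_def[abs_def] comp_def)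
  qed
  have cont': "continuous_on {0..1} (D' s)"
    unfolding D'_def by (intro continuous_intros continuous_on_compose2[OF cont]) auto
  have p': "poly (p' n) x = int_bernstein n (D' 0) x" if "1 \<le> n" for n x
    using int_bernstein_reflect[OF that, of f x] by (simp add: p'_def p D'_def[abs_def] D0 poly_pcompose)
  have pw': "(\<lambda>n. poly (p' n) x) \<longlonglongrightarrow> D' 0 x" if "x \<in> {0..1}" for x
    using pw[of "1 - x"] that by (simp add: p'_def D'_def poly_pcompose)
  have unif': "\<bar>poly ((pderiv ^^ s) (p' n)) x - D' s x\<bar> \<le> e n" if "x \<in> {0..1}" for n x
    using unif[of "1 - x" n] that
    by (simp add: p'_def D'_def higher_pderiv_pcompose_reflect poly_pcompose abs_mult
        flip: right_diff_distrib)
  have right: "\<forall>i\<in>{2..s}. D' i 0 = 0"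
    "\<forall>\<^sub>F n in sequentially. \<forall>k\<in>{1..s}. D' 0 0 + real k / real n * D' 1 0 \<le> D' 0 (real k / real n)"
    using affine_contact_at_zero[of s D' p' e, OF \<open>s \<ge> 1\<close> der' cont' p' pw' unif' e] by auto
  have "\<forall>i\<in>{2..s}. deriv01 i f 0 = 0 \<and> deriv01 i f 1 = 0"
    using left(1) right(1) by (simp add: D'_def D_def)
  moreover obtain N where N: "\<And>n k. N \<le> n \<Longrightarrow> k \<in> {1..s} \<Longrightarrow>
      D 0 0 + real k / real n * D 1 0 \<le> D 0 (real k / real n) \<and>
      D' 0 0 + real k / real n * D' 1 0 \<le> D' 0 (real k / real n)"
    using eventually_conj[OF left(2) right(2)] unfolding eventually_sequentially by blast
  have "f 0 + real k / real n * deriv01 1 f 0 \<le> f (real k / real n)"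
    if "max N s \<le> n" "k \<in> {1..s}" for n k
    using N[of n k] that by (simp add: D0) (simp add: D_def)
  moreover have "f 1 - (1 - real k / real n) * deriv01 1 f 1 \<le> f (real k / real n)"
    if "max N s \<le> n" "k \<in> {n - s..n - 1}" for n k
  proof -
    have k: "n - k \<in> {1..s}" "k \<le> n" "1 \<le> n" using that \<open>s \<ge> 1\<close> by auto
    then have eq: "real (n - k) / real n = 1 - real k / real n"
      by (simp add: of_nat_diff diff_divide_distrib)
    have "D' 0 0 + real (n - k) / real n * D' 1 0 \<le> D' 0 (real (n - k) / real n)"
      using N[of n "n - k"] that k by simp
    then show ?thesis
      unfolding eq by (simp add: D'_def D0) (simp add: D_def)
  qed
  ultimately show ?thesis using \<open>s \<ge> 1\<close>
    by (intro conjI exI[of _ "max N s"]) auto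
qed

end
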